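(* Let $K$ be a compact Hausdorff space. The product $A\cdot B$ of any two nonnegative intervals $A,B$ in $C(K)$ is a convex subset of $C(K)$.
   Context: $C(K)$ is the Banach algebra of continuous real functions on $K$ with the supremum norm. For $A,B\subset C(K)$, $A\cdot B=\{ab: a\in A,\ b\in B\}$ with pointwise products. An interval in $C(K)$ is a set of the form $[f,g]=\{h\in C(K): f\le h\le g\}$, where $f,g:K\to\mathbb{R}$ are bounded functions (not necessarily continuous) and inequalities between functions are pointwise; such a pair $f,g$ is called a representation of the interval. An interval is nonnegative if it has a representation $[f,g]$ with $f\ge 0$ pointwise on $K$. *)

theory Defs
  imports "HOL-Analysis.Analysis" "HOL-Library.Function_Algebras"
begin

text \<open>Together with the pointwise ring structure of \<^theory>\<open>HOL-Library.Function_Algebras\<close>, the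
  pointwise scalar multiplication makes the library's \<^const>\<open>convex\<close> available for sets of
  functions. The product of two sets of functions is the one of
  \<^theory>\<open>HOL-Library.Set_Algebras\<close>: all pointwise products of an element of the first
  and an element of the second.\<close>

instantiation "fun" :: (type, real_vector) real_vector
begin

definition scaleR_fun :: "real \<Rightarrow> ('a \<Rightarrow> 'b) \<Rightarrow> 'a \<Rightarrow> 'b"
  where "scaleR_fun r f = (\<lambda>x. r *\<^sub>R f x)"

instance
  by standard
    (simp_all add: scaleR_fun_def fun_eq_iff scaleR_add_right scaleR_add_left)

end

text \<open>Functions on \<^term>\<open>topspace K\<close> are represented by total functions that vanish outside
  \<^term>\<open>topspace K\<close>. The value 0 (rather than \<^const>\<open>undefined\<close>) makes \<open>C_space K\<close> a linear
  subspace and a subring of the type of all functions.\<close>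

definition C_space :: "'a topology \<Rightarrow> ('a \<Rightarrow> real) set"
  where "C_space K =
    {h. continuous_map K euclideanreal h \<and> (\<forall>x. x \<notin> topspace K \<longrightarrow> h x = 0)}"

definition C_interval :: "'a topology \<Rightarrow> ('a \<Rightarrow> real) \<Rightarrow> ('a \<Rightarrow> real) \<Rightarrow> ('a \<Rightarrow> real) set"
  where "C_interval K f g = {h \<in> C_space K. \<forall>x\<in>topspace K. f x \<le> h x \<and> h x \<le> g x}"

text \<open>The endpoints need not be continuous, and a set may have many representations.\<close>

definition represents ::
    "'a topology \<Rightarrow> ('a \<Rightarrow> real) \<Rightarrow> ('a \<Rightarrow> real) \<Rightarrow> ('a \<Rightarrow> real) set \<Rightarrow> bool"
  where "represents K f g A \<longleftrightarrow>
    bounded (f ` topspace K) \<and> bounded (g ` topspace K) \<and> A = C_interval K f g"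

definition nonneg_interval :: "'a topology \<Rightarrow> ('a \<Rightarrow> real) set \<Rightarrow> bool"
  where "nonneg_interval K A \<longleftrightarrow>
    (\<exists>f g. represents K f g A \<and> (\<forall>x\<in>topspace K. 0 \<le> f x))"

end

theory Submission
  imports Defs
begin

text \<open>Let \<open>h = u a\<^sub>1 b\<^sub>1 + v a\<^sub>2 b\<^sub>2\<close> with \<open>u + v = 1\<close>, and let \<open>x\<close>, \<open>y\<close> be the same convex
  combinations of the \<open>a\<^sub>i\<close> and of the \<open>b\<^sub>i\<close>. Among the factorizations \<open>h = a b\<close> with
  \<open>a, b \<ge> 0\<close>, the one with \<open>a - b = x - y\<close> depends continuously on the data, zeros included,
  because it solves a quadratic equation with nonnegative discriminant. It respects the given
  bounds: if \<open>m \<le> a\<^sub>i \<le> M\<close>, then \<open>m y \<le> h \<le> M y\<close> and \<open>m \<le> x \<le> M\<close>, which places the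
  root \<open>a\<close> of \<open>T\<^sup>2 - (x - y) T - h\<close> between \<open>m\<close> and \<open>M\<close>; symmetrically for \<open>b\<close>.\<close>

definition factor :: "real \<Rightarrow> real \<Rightarrow> real"
  where "factor d h = (d + sqrt (d\<^sup>2 + 4 * h)) / 2"

text \<open>Difference of squares: (sqrt D + d) (sqrt D - d) = 4 h for D = d^2 + 4 h. Thus
  \<open>factor (- d) h\<close> is the partner b = a - d of a = \<open>factor d h\<close>.\<close>

lemma factor_mult_factor_minus:
  assumes "0 \<le> h"
  shows "factor d h * factor (- d) h = h"
proof -
  have "sqrt (d\<^sup>2 + 4 * h) * sqrt (d\<^sup>2 + 4 * h) = d\<^sup>2 + 4 * h"
    using assms by simp
  then show ?thesis
    unfolding factor_def by (simp add: algebra_simps power2_eq_square)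
qed

text \<open>The second assumption makes T^2 - d T - h nonnegative at \<open>M\<close>; the first
  puts \<open>M\<close> at or right of the vertex d / 2, which excludes the side of the smaller
  root.\<close>

lemma factor_le:
  assumes "d \<le> 2 * M" and "h \<le> M * (M - d)"
  shows "factor d h \<le> M"
proof -
  have "sqrt (d\<^sup>2 + 4 * h) \<le> 2 * M - d"
    using assms by (intro real_le_lsqrt) (auto simp: algebra_simps power2_eq_square)
  then show ?thesis
    unfolding factor_def by simp
qed

text \<open>The quadratic is nonpositive at \<open>m\<close>, which forces real roots with
  \<open>m\<close> between them.\<close>

lemma le_factor:
  assumes "m * (m - d) \<le> h"
  shows "m \<le> factor d h"
proof -
  have "2 * m - d \<le> sqrt (d\<^sup>2 + 4 * h)"
    using assms by (intro real_le_rsqrt) (auto simp: algebra_simps power2_eq_square)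
  then show ?thesis
    unfolding factor_def by simp
qed

lemma factor_bounds:
  fixes a1 a2 b1 b2 u v m M :: real
  assumes a: "0 \<le> m" "m \<le> a1" "m \<le> a2" "a1 \<le> M" "a2 \<le> M"
    and b: "0 \<le> b1" "0 \<le> b2" and uv: "0 \<le> u" "0 \<le> v" "u + v = 1"
  shows "factor ((u * a1 + v * a2) - (u * b1 + v * b2)) (u * (a1 * b1) + v * (a2 * b2)) \<in> {m..M}"
proof -
  define x y h where "x = u * a1 + v * a2" and "y = u * b1 + v * b2"
    and "h = u * (a1 * b1) + v * (a2 * b2)"
  have x: "m \<le> x" "x \<le> M"
    unfolding x_def using convex_bound_le[of a1 M a2 u v] convex_bound_le[of "- a1" "- m" "- a2" u v]
      a uv by auto
  have y: "0 \<le> y"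
    unfolding y_def using b uv by simp
  have "u * (m * b1) + v * (m * b2) \<le> h" "h \<le> u * (M * b1) + v * (M * b2)"
    unfolding h_def using a b uv by (auto intro!: add_mono mult_left_mono mult_right_mono)
  then have h: "m * y \<le> h" "h \<le> M * y"
    unfolding y_def by (simp_all add: algebra_simps)
  \<comment> \<open>These are the gaps m y - m (m - (x - y)) and M (M - (x - y)) - M y; they carry
    the bounds on \<open>h\<close> over to the signs of the quadratic at \<open>m\<close> and
    \<open>M\<close>.\<close>
  have "0 \<le> m * (x - m)" "0 \<le> M * (M - x)"
    using a x by simp_all
  then have "m * (m - (x - y)) \<le> h" "h \<le> M * (M - (x - y))"
    using h by (simp_all add: algebra_simps)
  moreover have "x - y \<le> 2 * M"
    using a x y by linarith
  ultimately show ?thesis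
    using factor_le le_factor unfolding x_def y_def h_def by simp
qed

lemma C_space_mult:
  assumes "a \<in> C_space K" and "b \<in> C_space K"
  shows "a * b \<in> C_space K"
  using assms by (auto simp: C_space_def times_fun_def intro: continuous_map_real_mult)

text \<open>The real \<open>sqrt\<close> is continuous on the whole line, being extended as an odd
  function, and \<open>factor 0 0 = 0\<close> keeps the value 0 outside the space.\<close>

lemma factor_in_C_space:
  assumes "d \<in> C_space K" and "h \<in> C_space K"
  shows "(\<lambda>x. factor (d x) (h x)) \<in> C_space K"
  using assms unfolding C_space_def factor_def
  by (auto intro!: continuous_intros continuous_map_sqrt)

lemma C_space_lincomb:
  assumes "a \<in> C_space K" and "b \<in> C_space K"
  shows "(\<lambda>x. r * a x + s * b x) \<in> C_space K"
  using assms unfolding C_space_def by (auto intro!: continuous_intros)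

text \<open>The new factors are built from the given continuous factors only, never from the
  endpoints, so discontinuous endpoints do no harm.\<close>

lemma convex_C_interval_mult:
  assumes f: "\<And>x. x \<in> topspace K \<Longrightarrow> 0 \<le> f x" and p: "\<And>x. x \<in> topspace K \<Longrightarrow> 0 \<le> p x"
  shows "convex (C_interval K f g * C_interval K p q)"
proof (rule convexI)
  fix h1 h2 :: "'a \<Rightarrow> real" and u v :: real
  assume h1: "h1 \<in> C_interval K f g * C_interval K p q"
    and h2: "h2 \<in> C_interval K f g * C_interval K p q"
    and uv: "0 \<le> u" "0 \<le> v" "u + v = 1"
  obtain a1 b1 where 1: "h1 = a1 * b1" "a1 \<in> C_interval K f g" "b1 \<in> C_interval K p q"
    using h1 by (rule set_times_elim)
  obtain a2 b2 where 2: "h2 = a2 * b2" "a2 \<in> C_interval K f g" "b2 \<in> C_interval K p q"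
    using h2 by (rule set_times_elim)
  note ab = 1(2,3) 2(2,3)
  define d h where "d = (\<lambda>x. (u * a1 x + v * a2 x) - (u * b1 x + v * b2 x))"
    and "h = (\<lambda>x. u * (a1 x * b1 x) + v * (a2 x * b2 x))"
  have C: "a1 \<in> C_space K" "a2 \<in> C_space K" "b1 \<in> C_space K" "b2 \<in> C_space K"
    using ab by (auto simp: C_interval_def)
  have d: "d \<in> C_space K" "(\<lambda>x. - d x) \<in> C_space K"
    using C_space_lincomb[OF C_space_lincomb C_space_lincomb, OF C, of 1 u v "- 1" u v]
      C_space_lincomb[OF C_space_lincomb C_space_lincomb, OF C, of "- 1" u v 1 u v]
    by (simp_all add: d_def algebra_simps)
  have h: "h \<in> C_space K"
    using C_space_lincomb[OF C_space_mult C_space_mult, of a1 K b1 a2 b2 u v] C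
    by (simp add: h_def times_fun_def)
  have bounds: "f x \<le> a1 x" "f x \<le> a2 x" "a1 x \<le> g x" "a2 x \<le> g x"
      "p x \<le> b1 x" "p x \<le> b2 x" "b1 x \<le> q x" "b2 x \<le> q x" if "x \<in> topspace K" for x
    using ab that by (auto simp: C_interval_def)
  have nonneg: "0 \<le> a1 x" "0 \<le> a2 x" "0 \<le> b1 x" "0 \<le> b2 x" if "x \<in> topspace K" for x
    using bounds[OF that] f[OF that] p[OF that] by linarith+
  have "factor (d x) (h x) \<in> {f x..g x}" if "x \<in> topspace K" for x
    unfolding d_def h_def using bounds[OF that] nonneg[OF that] f[OF that] uv
    by (intro factor_bounds) auto
  then have a: "(\<lambda>x. factor (d x) (h x)) \<in> C_interval K f g"
    using factor_in_C_space[OF d(1) h] by (auto simp: C_interval_def)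
  \<comment> \<open>Exchanging the roles of the a's and b's negates \<open>d\<close> and fixes
    \<open>h\<close>.\<close>
  have "factor (- d x) (h x) \<in> {p x..q x}" if "x \<in> topspace K" for x
    using factor_bounds[of "p x" "b1 x" "b2 x" "q x" "a1 x" "a2 x" u v]
      bounds[OF that] nonneg[OF that] p[OF that] uv
    by (simp add: d_def h_def mult.commute)
  then have b: "(\<lambda>x. factor (- d x) (h x)) \<in> C_interval K p q"
    using factor_in_C_space[OF d(2) h] by (auto simp: C_interval_def)
  \<comment> \<open>Points outside the space count too, since the factorization below is an equation
    of total functions; there \<open>h\<close> is 0.\<close>
  have "0 \<le> h x" for x
    using nonneg[of x] h uv by (cases "x \<in> topspace K") (auto simp: h_def C_space_def)
  then have "u *\<^sub>R h1 + v *\<^sub>R h2 = (\<lambda>x. factor (d x) (h x)) * (\<lambda>x. factor (- d x) (h x))"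
    by (simp add: factor_mult_factor_minus 1(1) 2(1) fun_eq_iff scaleR_fun_def h_def)
  then show "u *\<^sub>R h1 + v *\<^sub>R h2 \<in> C_interval K f g * C_interval K p q"
    using set_times_intro[OF a b] by simp
qed

theorem theorem4p3:
  fixes K :: "'a topology" and A B :: "('a \<Rightarrow> real) set"
  assumes "compact_space K" and "Hausdorff_space K"
    and "nonneg_interval K A" and "nonneg_interval K B"
  shows "A * B \<subseteq> C_space K \<and> convex (A * B)"
proof -
  obtain f g where f: "A = C_interval K f g" "\<And>x. x \<in> topspace K \<Longrightarrow> 0 \<le> f x"
    using assms(3) by (auto simp: nonneg_interval_def represents_def)
  obtain p q where p: "B = C_interval K p q" "\<And>x. x \<in> topspace K \<Longrightarrow> 0 \<le> p x"
    using assms(4) by (auto simp: nonneg_interval_def represents_def)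
  have "A * B \<subseteq> C_space K"
    unfolding f(1) p(1) by (auto elim!: set_times_elim intro!: C_space_mult simp: C_interval_def)
  then show ?thesis
    unfolding f(1) p(1) using convex_C_interval_mult[of K f p g q] f(2) p(2) by blast
qed

end
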